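(* Let $\mathcal{D}=\mathrm{Ex}(\mathcal{A},\mathbf{Ab})$ be a definable category, with $\mathcal{A}$ the corresponding skeletally small abelian category. Then the points of $\mathrm{pinj}(\mathcal{D})$ induce a natural bijection between those primes of the Ziegler locale and those primes of the Zariski locale whose corresponding irreducible closed sets have generic points. Explicitly: for $N\in\mathrm{pinj}(\mathcal{D})$, the correspondence matching the prime whose complement is the Ziegler-closure of $\{N\}$ with the prime whose complement is the rep-Zariski-closure of $\{N\}$ is a well-defined bijection between the set of Ziegler-open sets whose complement is an irreducible Ziegler-closed set with a generic point (in the Ziegler topology) and the set of rep-Zariski-open sets whose complement is an irreducible rep-Zariski-closed set with a generic point (in the rep-Zariski topology).
   Context: $\mathcal{D}=\mathrm{Ex}(\mathcal{A},\mathbf{Ab})$ is the category of exact (additive, covariant) functors from $\mathcal{A}$ to abelian groups; definable categories are those equivalent to one of this form. A pure monomorphism in $\mathcal{D}$ is a morphism $f:M\to M'$ such that $f_A:M(A)\to M'(A)$ is injective for every $A\in\mathcal{A}$, and an object of $\mathcal{D}$ is pure-injective if it is injective with respect to pure monomorphisms in $\mathcal{D}$. $\mathrm{pinj}(\mathcal{D})$ is the set of isomorphism types of indecomposable pure-injective objects of $\mathcal{D}$. The Ziegler topology on $\mathrm{pinj}(\mathcal{D})$ has as basis of open sets the sets $(A)=\{N: N(A)\neq 0\}$, $A\in\mathcal{A}$. The rep-Zariski topology on $\mathrm{pinj}(\mathcal{D})$ has as basis of open sets the complements $[A]=\{N: N(A)=0\}$, $A\in\mathcal{A}$. The Ziegler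 locale, respectively Zariski locale, is the lattice of open sets of the Ziegler, respectively rep-Zariski, topology. A prime of the locale of open sets of a topology is an open set whose complement is an irreducible closed set (non-empty and not the union of finitely many proper closed subsets). A generic point of a closed set is a point whose closure is that set. *)

theory Defs
  imports
    "HOL-Algebra.Elementary_Groups"
    "HOL-Analysis.Function_Topology"
    "HOL-Library.Equipollence"
    "HOL-Library.FuncSet"
begin

section \<open>Abelian categories\<close>

record ('o, 'a) add_category =
  Ob :: "'o set"
  Arr :: "'a set"
  Src :: "'a \<Rightarrow> 'o"
  Tgt :: "'a \<Rightarrow> 'o"
  Ident :: "'o \<Rightarrow> 'a"
  Comp :: "'a \<Rightarrow> 'a \<Rightarrow> 'a"    (* Comp C g f is "g after f" *)
  Add :: "'a \<Rightarrow> 'a \<Rightarrow> 'a"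
  Null :: "'o \<Rightarrow> 'o \<Rightarrow> 'a"

definition Hom :: "('o, 'a) add_category \<Rightarrow> 'o \<Rightarrow> 'o \<Rightarrow> 'a set" where
  "Hom C A B = {f \<in> Arr C. Src C f = A \<and> Tgt C f = B}"

definition Hom_group :: "('o, 'a) add_category \<Rightarrow> 'o \<Rightarrow> 'o \<Rightarrow> 'a monoid" where
  "Hom_group C A B = \<lparr>carrier = Hom C A B, monoid.mult = Add C, one = Null C A B\<rparr>"

locale preadditive_category =
  fixes C :: "('o, 'a) add_category"
  assumes Src_Ob: "f \<in> Arr C \<Longrightarrow> Src C f \<in> Ob C"
    and Tgt_Ob: "f \<in> Arr C \<Longrightarrow> Tgt C f \<in> Ob C"
    and Ident_Hom: "A \<in> Ob C \<Longrightarrow> Ident C A \<in> Hom C A A"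
    and Comp_Hom: "\<lbrakk>f \<in> Hom C A B; g \<in> Hom C B D\<rbrakk> \<Longrightarrow> Comp C g f \<in> Hom C A D"
    and Comp_Ident: "f \<in> Hom C A B \<Longrightarrow> Comp C f (Ident C A) = f"
    and Ident_Comp: "f \<in> Hom C A B \<Longrightarrow> Comp C (Ident C B) f = f"
    and Comp_assoc: "\<lbrakk>f \<in> Hom C A B; g \<in> Hom C B D; h \<in> Hom C D E\<rbrakk>
      \<Longrightarrow> Comp C h (Comp C g f) = Comp C (Comp C h g) f"
    and Hom_comm_group: "\<lbrakk>A \<in> Ob C; B \<in> Ob C\<rbrakk> \<Longrightarrow> comm_group (Hom_group C A B)"
    and Comp_Add_right: "\<lbrakk>f \<in> Hom C A B; f' \<in> Hom C A B; g \<in> Hom C B D\<rbrakk>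
      \<Longrightarrow> Comp C g (Add C f f') = Add C (Comp C g f) (Comp C g f')"
    and Comp_Add_left: "\<lbrakk>f \<in> Hom C A B; g \<in> Hom C B D; g' \<in> Hom C B D\<rbrakk>
      \<Longrightarrow> Comp C (Add C g g') f = Add C (Comp C g f) (Comp C g' f)"

definition zero_object :: "('o, 'a) add_category \<Rightarrow> 'o \<Rightarrow> bool" where
  "zero_object C Z \<longleftrightarrow> Z \<in> Ob C \<and>
     (\<forall>A \<in> Ob C. (\<exists>!f. f \<in> Hom C Z A) \<and> (\<exists>!f. f \<in> Hom C A Z))"

definition is_biproduct ::
  "('o, 'a) add_category \<Rightarrow> 'o \<Rightarrow> 'o \<Rightarrow> 'o \<Rightarrow> 'a \<Rightarrow> 'a \<Rightarrow> 'a \<Rightarrow> 'a \<Rightarrow> bool" where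
  "is_biproduct C A B P i j p q \<longleftrightarrow>
     P \<in> Ob C \<and> i \<in> Hom C A P \<and> j \<in> Hom C B P \<and> p \<in> Hom C P A \<and> q \<in> Hom C P B \<and>
     Comp C p i = Ident C A \<and> Comp C q j = Ident C B \<and>
     Comp C q i = Null C A B \<and> Comp C p j = Null C B A \<and>
     Add C (Comp C i p) (Comp C j q) = Ident C P"

definition mono_arrow :: "('o, 'a) add_category \<Rightarrow> 'a \<Rightarrow> bool" where
  "mono_arrow C f \<longleftrightarrow> f \<in> Arr C \<and>
     (\<forall>X. \<forall>g \<in> Hom C X (Src C f). \<forall>h \<in> Hom C X (Src C f). Comp C f g = Comp C f h \<longrightarrow> g = h)"

definition epi_arrow :: "('o, 'a) add_category \<Rightarrow> 'a \<Rightarrow> bool" where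
  "epi_arrow C f \<longleftrightarrow> f \<in> Arr C \<and>
     (\<forall>X. \<forall>g \<in> Hom C (Tgt C f) X. \<forall>h \<in> Hom C (Tgt C f) X. Comp C g f = Comp C h f \<longrightarrow> g = h)"

definition is_kernel :: "('o, 'a) add_category \<Rightarrow> 'a \<Rightarrow> 'a \<Rightarrow> bool" where
  "is_kernel C k f \<longleftrightarrow> k \<in> Arr C \<and> f \<in> Arr C \<and> Tgt C k = Src C f \<and>
     Comp C f k = Null C (Src C k) (Tgt C f) \<and>
     (\<forall>X \<in> Ob C. \<forall>g \<in> Hom C X (Src C f). Comp C f g = Null C X (Tgt C f) \<longrightarrow>
        (\<exists>!h. h \<in> Hom C X (Src C k) \<and> Comp C k h = g))"

definition is_cokernel :: "('o, 'a) add_category \<Rightarrow> 'a \<Rightarrow> 'a \<Rightarrow> bool" where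
  "is_cokernel C c f \<longleftrightarrow> c \<in> Arr C \<and> f \<in> Arr C \<and> Src C c = Tgt C f \<and>
     Comp C c f = Null C (Src C f) (Tgt C c) \<and>
     (\<forall>X \<in> Ob C. \<forall>g \<in> Hom C (Tgt C f) X. Comp C g f = Null C (Src C f) X \<longrightarrow>
        (\<exists>!h. h \<in> Hom C (Tgt C c) X \<and> Comp C h c = g))"

locale abelian_category = preadditive_category +
  assumes has_zero: "\<exists>Z. zero_object C Z"
    and has_biproducts: "\<lbrakk>A \<in> Ob C; B \<in> Ob C\<rbrakk> \<Longrightarrow> \<exists>P i j p q. is_biproduct C A B P i j p q"
    and has_kernels: "f \<in> Arr C \<Longrightarrow> \<exists>k. is_kernel C k f"
    and has_cokernels: "f \<in> Arr C \<Longrightarrow> \<exists>c. is_cokernel C c f"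
    and mono_normal: "mono_arrow C m \<Longrightarrow> \<exists>f. is_kernel C m f"
    and epi_normal: "epi_arrow C e \<Longrightarrow> \<exists>f. is_cokernel C e f"

definition isomorphic_objects :: "('o, 'a) add_category \<Rightarrow> 'o \<Rightarrow> 'o \<Rightarrow> bool" where
  "isomorphic_objects C A B \<longleftrightarrow> (\<exists>f \<in> Hom C A B. \<exists>g \<in> Hom C B A.
     Comp C g f = Ident C A \<and> Comp C f g = Ident C B)"

text \<open>
  Abelian groups are those whose carrier is a subset of the type \<open>'g\<close>, an arbitrary type that plays
  the role of the set-theoretic universe. A set \<open>X\<close> is small relative to \<open>'g\<close> if \<open>'g\<close> has at least
  two elements and is closed under \<open>nat\<close>-indexed and \<open>X\<close>-indexed products. Every \<open>X\<close> is small
  relative to some type \<open>'g\<close>, and if \<open>'g\<close> has inaccessible cardinality then every \<open>X\<close> of smaller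
  cardinality is small.

  Let \<open>\<kappa>\<close> be the cardinality of \<open>'g\<close> and let \<open>\<lambda> \<ge> \<aleph>\<^sub>0\<close> bound the number of arrows of a skeleton.
  Smallness says \<open>\<kappa>\<^sup>\<lambda> = \<kappa>\<close>. Then pure-injective hulls of exact functors with values of size at most
  \<open>\<kappa>\<close> again have values of size at most \<open>\<kappa>\<close>, and indecomposable pure-injectives have values of size
  at most \<open>2\<^sup>\<lambda> \<le> \<kappa>\<close>. So testing pure-injectivity on functors into \<open>'g\<close> suffices, and all
  indecomposable pure-injectives occur, up to isomorphism, among the functors into \<open>'g\<close>.
\<close>

definition small_set :: "'g itself \<Rightarrow> 'x set \<Rightarrow> bool" where
  "small_set (_ :: 'g itself) X \<longleftrightarrow>
     (\<exists>x y :: 'g. x \<noteq> y) \<and>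
     (UNIV :: (nat \<Rightarrow> 'g) set) \<lesssim> (UNIV :: 'g set) \<and>
     (X \<rightarrow>\<^sub>E (UNIV :: 'g set)) \<lesssim> (UNIV :: 'g set)"

definition skeletally_small :: "'g itself \<Rightarrow> ('o, 'a) add_category \<Rightarrow> bool" where
  "skeletally_small U C \<longleftrightarrow> (\<exists>S \<subseteq> Ob C.
     (\<forall>A \<in> Ob C. \<exists>B \<in> S. isomorphic_objects C A B) \<and>
     small_set U {f \<in> Arr C. Src C f \<in> S \<and> Tgt C f \<in> S})"


section \<open>Exact functors to abelian groups\<close>

record ('o, 'a, 'g) ab_functor =
  Fob :: "'o \<Rightarrow> 'g monoid"
  Farr :: "'a \<Rightarrow> 'g \<Rightarrow> 'g"

definition additive_functor :: "('o, 'a) add_category \<Rightarrow> ('o, 'a, 'g) ab_functor \<Rightarrow> bool" where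
  "additive_functor C M \<longleftrightarrow>
     (\<forall>A \<in> Ob C. comm_group (Fob M A)) \<and>
     (\<forall>A B. \<forall>f \<in> Hom C A B. Farr M f \<in> hom (Fob M A) (Fob M B)) \<and>
     (\<forall>A \<in> Ob C. \<forall>x \<in> carrier (Fob M A). Farr M (Ident C A) x = x) \<and>
     (\<forall>A B D. \<forall>f \<in> Hom C A B. \<forall>g \<in> Hom C B D. \<forall>x \<in> carrier (Fob M A).
        Farr M (Comp C g f) x = Farr M g (Farr M f x)) \<and>
     (\<forall>A B. \<forall>f \<in> Hom C A B. \<forall>g \<in> Hom C A B. \<forall>x \<in> carrier (Fob M A).
        Farr M (Add C f g) x = Farr M f x \<otimes>\<^bsub>Fob M B\<^esub> Farr M g x)"

definition short_exact :: "('o, 'a) add_category \<Rightarrow> 'a \<Rightarrow> 'a \<Rightarrow> bool" where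
  "short_exact C f g \<longleftrightarrow> is_kernel C f g \<and> is_cokernel C g f"

definition exact_functors :: "('o, 'a) add_category \<Rightarrow> ('o, 'a, 'g) ab_functor set" where
  "exact_functors C = {M. additive_functor C M \<and>
     (\<forall>A B D. \<forall>f \<in> Hom C A B. \<forall>g \<in> Hom C B D. short_exact C f g \<longrightarrow>
        inj_on (Farr M f) (carrier (Fob M A)) \<and>
        Farr M f ` carrier (Fob M A) = kernel (Fob M B) (Fob M D) (Farr M g) \<and>
        Farr M g ` carrier (Fob M B) = carrier (Fob M D))}"

text \<open>
  Morphisms are natural transformations. Components are only relevant on carriers, so two morphisms
  are considered equal when they agree there.
\<close>

definition nat_trans :: "('o, 'a) add_category \<Rightarrow> ('o, 'a, 'g) ab_functor \<Rightarrow>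
    ('o, 'a, 'g) ab_functor \<Rightarrow> ('o \<Rightarrow> 'g \<Rightarrow> 'g) set" where
  "nat_trans C M N = {\<eta>.
     (\<forall>A \<in> Ob C. \<eta> A \<in> hom (Fob M A) (Fob N A)) \<and>
     (\<forall>A B. \<forall>f \<in> Hom C A B. \<forall>x \<in> carrier (Fob M A).
        \<eta> B (Farr M f x) = Farr N f (\<eta> A x))}"

definition iso_functors :: "('o, 'a) add_category \<Rightarrow> ('o, 'a, 'g) ab_functor \<Rightarrow>
    ('o, 'a, 'g) ab_functor \<Rightarrow> bool" where
  "iso_functors C M N \<longleftrightarrow> (\<exists>\<eta> \<in> nat_trans C M N. \<exists>\<theta> \<in> nat_trans C N M. \<forall>A \<in> Ob C.
     (\<forall>x \<in> carrier (Fob M A). \<theta> A (\<eta> A x) = x) \<and>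
     (\<forall>y \<in> carrier (Fob N A). \<eta> A (\<theta> A y) = y))"

definition pure_mono :: "('o, 'a) add_category \<Rightarrow> ('o, 'a, 'g) ab_functor \<Rightarrow>
    ('o, 'a, 'g) ab_functor \<Rightarrow> ('o \<Rightarrow> 'g \<Rightarrow> 'g) \<Rightarrow> bool" where
  "pure_mono C M N \<eta> \<longleftrightarrow> \<eta> \<in> nat_trans C M N \<and>
     (\<forall>A \<in> Ob C. inj_on (\<eta> A) (carrier (Fob M A)))"

definition pure_injective :: "('o, 'a) add_category \<Rightarrow> ('o, 'a, 'g) ab_functor \<Rightarrow> bool" where
  "pure_injective C N \<longleftrightarrow> N \<in> exact_functors C \<and>
     (\<forall>M \<in> exact_functors C. \<forall>M' \<in> exact_functors C. \<forall>\<eta>. pure_mono C M M' \<eta> \<longrightarrow>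
        (\<forall>\<phi> \<in> nat_trans C M N. \<exists>\<psi> \<in> nat_trans C M' N.
           \<forall>A \<in> Ob C. \<forall>x \<in> carrier (Fob M A). \<psi> A (\<eta> A x) = \<phi> A x))"

definition zero_functor :: "('o, 'a) add_category \<Rightarrow> ('o, 'a, 'g) ab_functor \<Rightarrow> bool" where
  "zero_functor C N \<longleftrightarrow> (\<forall>A \<in> Ob C. trivial_group (Fob N A))"

definition direct_sum_of :: "('o, 'a) add_category \<Rightarrow> ('o, 'a, 'g) ab_functor \<Rightarrow>
    ('o, 'a, 'g) ab_functor \<Rightarrow> ('o, 'a, 'g) ab_functor \<Rightarrow> bool" where
  "direct_sum_of C N M M' \<longleftrightarrow>
     (\<exists>i \<in> nat_trans C M N. \<exists>j \<in> nat_trans C M' N. \<exists>p \<in> nat_trans C N M. \<exists>q \<in> nat_trans C N M'.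
        \<forall>A \<in> Ob C.
          (\<forall>x \<in> carrier (Fob M A). p A (i A x) = x \<and> q A (i A x) = \<one>\<^bsub>Fob M' A\<^esub>) \<and>
          (\<forall>y \<in> carrier (Fob M' A). q A (j A y) = y \<and> p A (j A y) = \<one>\<^bsub>Fob M A\<^esub>) \<and>
          (\<forall>z \<in> carrier (Fob N A). i A (p A z) \<otimes>\<^bsub>Fob N A\<^esub> j A (q A z) = z))"

definition indecomposable :: "('o, 'a) add_category \<Rightarrow> ('o, 'a, 'g) ab_functor \<Rightarrow> bool" where
  "indecomposable C N \<longleftrightarrow> N \<in> exact_functors C \<and> \<not> zero_functor C N \<and>
     (\<forall>M \<in> exact_functors C. \<forall>M' \<in> exact_functors C. direct_sum_of C N M M' \<longrightarrow> zero_functor C M \<or> zero_functor C M')"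

definition pinj :: "('o, 'a) add_category \<Rightarrow> ('o, 'a, 'g) ab_functor set set" where
  "pinj C = (let I = {N. indecomposable C N \<and> pure_injective C N} in
     I // {(M, N). M \<in> I \<and> N \<in> I \<and> iso_functors C M N})"


section \<open>The Ziegler and rep-Zariski topologies\<close>

definition ziegler_basic ::
  "('o, 'a) add_category \<Rightarrow> 'o \<Rightarrow> ('o, 'a, 'g) ab_functor set set" where
  "ziegler_basic C A = {N \<in> pinj C. \<exists>M \<in> N. \<not> trivial_group (Fob M A)}"

definition zariski_basic ::
  "('o, 'a) add_category \<Rightarrow> 'o \<Rightarrow> ('o, 'a, 'g) ab_functor set set" where
  "zariski_basic C A = {N \<in> pinj C. \<forall>M \<in> N. trivial_group (Fob M A)}"

text \<open>
  Both families are bases of the topologies they generate: for the second,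
  \<open>[A] \<inter> [B] = [A \<oplus> B]\<close>; for the first this is a theorem about indecomposable pure-injectives.
\<close>

definition ziegler_topology ::
  "('o, 'a) add_category \<Rightarrow> ('o, 'a, 'g) ab_functor set topology" where
  "ziegler_topology C = topology_generated_by (ziegler_basic C ` Ob C)"

definition rep_zariski_topology ::
  "('o, 'a) add_category \<Rightarrow> ('o, 'a, 'g) ab_functor set topology" where
  "rep_zariski_topology C = topology_generated_by (zariski_basic C ` Ob C)"


section \<open>Primes of the locale of open sets\<close>

definition irreducible_closedin :: "'p topology \<Rightarrow> 'p set \<Rightarrow> bool" where
  "irreducible_closedin T K \<longleftrightarrow> closedin T K \<and> K \<noteq> {} \<and>
     (\<forall>\<F>. finite \<F> \<and> (\<forall>F \<in> \<F>. closedin T F \<and> F \<subset> K) \<longrightarrow> \<Union>\<F> \<noteq> K)"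

definition locale_prime :: "'p topology \<Rightarrow> 'p set \<Rightarrow> bool" where
  "locale_prime T U \<longleftrightarrow> openin T U \<and> irreducible_closedin T (topspace T - U)"

definition generic_point :: "'p topology \<Rightarrow> 'p set \<Rightarrow> 'p \<Rightarrow> bool" where
  "generic_point T K x \<longleftrightarrow> x \<in> topspace T \<and> T closure_of {x} = K"

definition generic_primes :: "'p topology \<Rightarrow> 'p set set" where
  "generic_primes T = {U. locale_prime T U \<and> (\<exists>x. generic_point T (topspace T - U) x)}"

end

theory Submission
  imports Defs
begin

text \<open>
  In a topology generated by a family of sets, \<open>y\<close> lies in the closure of \<open>{x}\<close> exactly if every
  member of the family containing \<open>y\<close> contains \<open>x\<close>: intersections and unions of the generating sets
  impose no further condition. The generating sets \<open>[A]\<close> of the rep-Zariski topology are the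
  complements of the generating sets \<open>(A)\<close> of the Ziegler topology, and both topologies have
  underlying set \<open>pinj C\<close>. So \<open>M\<close> is in the Ziegler-closure of \<open>{N}\<close> if and only if \<open>N\<close> is in the
  rep-Zariski-closure of \<open>{M}\<close>: the two specialisation preorders are opposite to each other. In
  particular two points have equal Ziegler-closures if and only if they have equal
  rep-Zariski-closures.

  On the other hand the closure of a point is always irreducible, so in any topology the primes in
  question are precisely the complements of the closures of the points. Matching
  the complements of the two closures of each point is therefore well defined and bijective.

  The category enters only through the underlying sets of the topologies: an
  indecomposable functor is nonzero at some object, so the sets \<open>(A)\<close> cover \<open>pinj C\<close>, and
  an additive functor vanishes at a zero object \<open>Z\<close>, so \<open>[Z]\<close> is all of \<open>pinj C\<close>.
\<close>

lemma closure_of_singleton_generated: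
  assumes x: "x \<in> \<Union>S"
  shows "y \<in> topology_generated_by S closure_of {x} \<longleftrightarrow> y \<in> \<Union>S \<and> (\<forall>B \<in> S. y \<in> B \<longrightarrow> x \<in> B)"
proof
  assume "y \<in> topology_generated_by S closure_of {x}"
  then show "y \<in> \<Union>S \<and> (\<forall>B \<in> S. y \<in> B \<longrightarrow> x \<in> B)"
    using topology_generated_by_Basis[of _ S]
    by (auto simp: in_closure_of topology_generated_by_topspace)
next
  assume y: "y \<in> \<Union>S \<and> (\<forall>B \<in> S. y \<in> B \<longrightarrow> x \<in> B)"
  have "x \<in> U" if "generate_topology_on S U" "y \<in> U" for U
    using that by (induction rule: generate_topology_on.induct) (use y in auto)
  then show "y \<in> topology_generated_by S closure_of {x}"
    using y by (auto simp: in_closure_of topology_generated_by_topspace openin_topology_generated_by_iff)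
qed

lemma irreducible_closedin_closure_of_singleton:
  assumes "x \<in> topspace T"
  shows "irreducible_closedin T (T closure_of {x})"
proof -
  have x: "x \<in> T closure_of {x}"
    using assms by (meson closure_of_subset empty_subsetI insert_subset)
  have "\<Union>\<F> \<noteq> T closure_of {x}" if "\<forall>F \<in> \<F>. closedin T F \<and> F \<subset> T closure_of {x}" for \<F>
  proof
    assume "\<Union>\<F> = T closure_of {x}"
    then obtain F where "F \<in> \<F>" "x \<in> F"
      using x by auto
    with that have "T closure_of {x} \<subseteq> F" "F \<subset> T closure_of {x}"
      by (simp_all add: closure_of_minimal)
    then show False by simp
  qed
  with x show ?thesis
    unfolding irreducible_closedin_def by (metis closedin_closure_of empty_iff)
qed

lemma generic_primes_eq_image:
  "generic_primes T = (\<lambda>x. topspace T - T closure_of {x}) ` topspace T"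
proof
  show "generic_primes T \<subseteq> (\<lambda>x. topspace T - T closure_of {x}) ` topspace T"
    by (auto simp: generic_primes_def generic_point_def locale_prime_def image_iff
        dest: openin_subset)
  have "topspace T - T closure_of {x} \<in> generic_primes T" if "x \<in> topspace T" for x
  proof -
    have "topspace T - (topspace T - T closure_of {x}) = T closure_of {x}"
      using closure_of_subset_topspace by fast
    with that show ?thesis
      by (auto simp: generic_primes_def generic_point_def locale_prime_def
          intro: irreducible_closedin_closure_of_singleton)
  qed
  then show "(\<lambda>x. topspace T - T closure_of {x}) ` topspace T \<subseteq> generic_primes T"
    by blast
qed

lemma bij_betw_images_same_fibres:
  assumes "\<And>x y. x \<in> X \<Longrightarrow> y \<in> X \<Longrightarrow> f x = f y \<longleftrightarrow> g x = g y"
  shows "\<exists>\<Phi>. bij_betw \<Phi> (f ` X) (g ` X) \<and> {(u, \<Phi> u) | u. u \<in> f ` X} = {(f x, g x) | x. x \<in> X}"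
proof -
  define \<Phi> where "\<Phi> = g \<circ> inv_into X f"
  have \<Phi>: "\<Phi> (f x) = g x" if "x \<in> X" for x
    using assms[of "inv_into X f (f x)" x] that
    by (simp add: \<Phi>_def inv_into_into f_inv_into_f)
  have "bij_betw \<Phi> (f ` X) (g ` X)"
    unfolding bij_betw_def inj_on_def image_image using \<Phi> assms by force
  moreover have "{(u, \<Phi> u) | u. u \<in> f ` X} = {(f x, g x) | x. x \<in> X}"
    using \<Phi> by force
  ultimately show ?thesis by blast
qed

text \<open>
  Any two topologies on one set with opposite specialisation preorders have their generic primes in
  bijection in the stated way.
\<close>

lemma bij_betw_generic_primes_opposite_specialisation:
  assumes top: "topspace T = X" "topspace T' = X"
    and opp: "\<And>x y. x \<in> X \<Longrightarrow> y \<in> X \<Longrightarrow> y \<in> T closure_of {x} \<longleftrightarrow> x \<in> T' closure_of {y}"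
  shows "\<exists>\<Phi>. bij_betw \<Phi> (generic_primes T) (generic_primes T') \<and>
    {(U, \<Phi> U) | U. U \<in> generic_primes T} =
    {(X - T closure_of {x}, X - T' closure_of {x}) | x. x \<in> X}"
proof -
  \<comment> \<open>Equality of point closures is equivalence in the specialisation preorder, a symmetric condition.\<close>
  have eq: "X - S closure_of {x} = X - S closure_of {y} \<longleftrightarrow>
      x \<in> S closure_of {y} \<and> y \<in> S closure_of {x}"
    if "topspace S = X" "x \<in> X" "y \<in> X" for S :: "'a topology" and x y
  proof -
    have self: "x \<in> S closure_of {x}" "y \<in> S closure_of {y}"
      using that closure_of_subset[of "{x}" S] closure_of_subset[of "{y}" S] by auto
    have "S closure_of {u} \<subseteq> S closure_of {v}" if "u \<in> S closure_of {v}" for u v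
      using that by (simp add: closure_of_minimal)
    with self that show ?thesis by blast
  qed
  have "X - T closure_of {x} = X - T closure_of {y} \<longleftrightarrow>
      X - T' closure_of {x} = X - T' closure_of {y}" if "x \<in> X" "y \<in> X" for x y
    using that eq[OF top(1)] eq[OF top(2)] opp by auto
  from bij_betw_images_same_fibres[OF this]
  show ?thesis
    unfolding generic_primes_eq_image top .
qed

lemma iso_functors_refl: "iso_functors C M M" if "additive_functor C M"
proof -
  have "(\<lambda>A x. x) \<in> nat_trans C M M"
    by (simp add: nat_trans_def hom_def)
  then show ?thesis
    unfolding iso_functors_def by (intro bexI[of _ "\<lambda>A x. x"]) auto
qed

lemma pinj_class_nonempty:
  assumes "N \<in> pinj C"
  shows "\<exists>M \<in> N. indecomposable C M"
proof -
  obtain M where M: "indecomposable C M" "pure_injective C M"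
    and N: "N = {(M, N). (indecomposable C M \<and> pure_injective C M) \<and>
        (indecomposable C N \<and> pure_injective C N) \<and> iso_functors C M N} `` {M}"
    using assms unfolding pinj_def Let_def by (auto elim!: quotientE)
  have "additive_functor C M"
    using M(1) by (simp add: indecomposable_def exact_functors_def)
  with M N show ?thesis
    using iso_functors_refl by fastforce
qed

lemma pinj_class_additive:
  assumes "N \<in> pinj C" "M \<in> N"
  shows "additive_functor C M"
  using assms unfolding pinj_def Let_def
  by (auto elim!: quotientE simp: indecomposable_def exact_functors_def)

lemma trivial_group_at_zero_object:
  assumes "preadditive_category C" "additive_functor C M" "zero_object C Z"
  shows "trivial_group (Fob M Z)"
proof -
  interpret preadditive_category C by fact
  have Z: "Z \<in> Ob C"
    using assms(3) by (simp add: zero_object_def)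
  interpret G: comm_group "Fob M Z"
    using assms(2) Z by (simp add: additive_functor_def)
  interpret H: comm_group "Hom_group C Z Z"
    using Hom_comm_group Z by blast
  have id: "Ident C Z \<in> Hom C Z Z"
    using Ident_Hom Z .
  \<comment> \<open>The identity is the only endomorphism of \<open>Z\<close>, so \<open>id + id = id\<close>, and applying \<open>M\<close> gives \<open>x + x = x\<close>.\<close>
  have "Add C (Ident C Z) (Ident C Z) \<in> Hom C Z Z"
    using H.m_closed[of "Ident C Z" "Ident C Z"] id by (simp add: Hom_group_def)
  then have add: "Add C (Ident C Z) (Ident C Z) = Ident C Z"
    using assms(3) Z id unfolding zero_object_def by blast
  have "x = \<one>\<^bsub>Fob M Z\<^esub>" if x: "x \<in> carrier (Fob M Z)" for x
  proof -
    have id_x: "Farr M (Ident C Z) x = x"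
      using assms(2) Z x by (simp add: additive_functor_def)
    have "Farr M (Add C (Ident C Z) (Ident C Z)) x =
        Farr M (Ident C Z) x \<otimes>\<^bsub>Fob M Z\<^esub> Farr M (Ident C Z) x"
      using assms(2) id x unfolding additive_functor_def by blast
    then have "x \<otimes>\<^bsub>Fob M Z\<^esub> x = x"
      by (simp add: add id_x)
    then show ?thesis
      using x by simp
  qed
  then show ?thesis
    by (auto simp: trivial_group_def G.is_group)
qed

lemma Union_ziegler_basic: "\<Union>(ziegler_basic C ` Ob C) = pinj C"
proof -
  have "\<exists>A \<in> Ob C. N \<in> ziegler_basic C A" if "N \<in> pinj C" for N :: "('a, 'b, 'c) ab_functor set"
    using pinj_class_nonempty[OF that] that
    by (auto simp: ziegler_basic_def indecomposable_def zero_functor_def)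
  then show ?thesis
    by (auto simp: ziegler_basic_def)
qed

lemma Union_zariski_basic:
  fixes C :: "('o, 'a) add_category"
  assumes "abelian_category C"
  shows "\<Union>(zariski_basic C ` Ob C) = (pinj C :: ('o, 'a, 'g) ab_functor set set)"
proof -
  interpret abelian_category C by fact
  obtain Z where Z: "zero_object C Z"
    using has_zero by blast
  then have "trivial_group (Fob M Z)" if "N \<in> pinj C" "M \<in> N"
    for N and M :: "('o, 'a, 'g) ab_functor"
    using that trivial_group_at_zero_object[OF preadditive_category_axioms] pinj_class_additive
    by blast
  then have "zariski_basic C Z = (pinj C :: ('o, 'a, 'g) ab_functor set set)"
    by (auto simp: zariski_basic_def)
  moreover have "Z \<in> Ob C"
    using Z by (simp add: zero_object_def)
  ultimately show ?thesis
    by (auto simp: zariski_basic_def)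
qed

theorem proposition4p7:
  fixes C :: "('o, 'a) add_category"
  assumes "abelian_category C" and "skeletally_small TYPE('g) C"
  shows "\<exists>\<Phi>. bij_betw \<Phi>
             (generic_primes (ziegler_topology C :: ('o, 'a, 'g) ab_functor set topology))
             (generic_primes (rep_zariski_topology C :: ('o, 'a, 'g) ab_functor set topology)) \<and>
           {(U, \<Phi> U) | U. U \<in> generic_primes (ziegler_topology C)} =
           {(pinj C - ziegler_topology C closure_of {N},
             pinj C - rep_zariski_topology C closure_of {N}) | N. N \<in> pinj C}"
proof (rule bij_betw_generic_primes_opposite_specialisation)
  note covers = Union_ziegler_basic[of C] Union_zariski_basic[OF assms(1)]
  show "topspace (ziegler_topology C :: ('o, 'a, 'g) ab_functor set topology) = pinj C"
    "topspace (rep_zariski_topology C :: ('o, 'a, 'g) ab_functor set topology) = pinj C"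
    unfolding ziegler_topology_def rep_zariski_topology_def topology_generated_by_topspace
    by (fact covers)+
  fix N M :: "('o, 'a, 'g) ab_functor set"
  assume "N \<in> pinj C" "M \<in> pinj C"
  then show "M \<in> ziegler_topology C closure_of {N} \<longleftrightarrow> N \<in> rep_zariski_topology C closure_of {M}"
    unfolding ziegler_topology_def rep_zariski_topology_def
    by (simp add: closure_of_singleton_generated covers del: Union_iff UN_iff)
      (auto simp: ziegler_basic_def zariski_basic_def)
qed

end
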